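(* Let $I\subseteq[-\infty,\infty]$ be an interval, let $c\in I$, and let $f,g\colon I\to\mathbb{R}$ be two functions such that (i) the restrictions $f|_{I\cap\mathbb{R}}$ and $g|_{I\cap\mathbb{R}}$ are both differentiable, and (ii) $g'(x)\neq 0$ for all $x\in I\cap\mathbb{R}$. If $\frac{f'}{g'}\colon I\cap\mathbb{R}\to\mathbb{R}$ is monotonic (respectively, strictly monotonic), then the function $$\frac{f-f(c)}{g-g(c)}\colon I\setminus\{c\}\to\mathbb{R}$$ is monotonic (respectively, strictly monotonic) of the same monotonicity (respectively, of the same strict monotonicity).
   Context: Here $[-\infty,\infty]$ is the extended real line, and intervals in it may contain $\pm\infty$. The function $\frac{f-f(c)}{g-g(c)}$ is $x\mapsto\frac{f(x)-f(c)}{g(x)-g(c)}$. "Of the same monotonicity" means increasing if $\frac{f'}{g'}$ is increasing and decreasing if $\frac{f'}{g'}$ is decreasing, and likewise in the strict case; without "strictly", increasing and decreasing are meant in the weak sense.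
   Formalization: The functions f and g are additionally assumed continuous at any point −∞ or ∞ belonging to I; without this the claim fails, e.g. I=[0,∞], c=∞, f(x)=x², g(x)=x for real x, f(∞)=−5, g(∞)=−1. *)

theory Defs
  imports "HOL-Analysis.Analysis"
begin

text \<open>
  Intervals of the extended real line, in the order sense: open, half-open, closed or degenerate,
  with finite or infinite endpoints. (\<open>is_interval\<close> is restricted to Euclidean spaces.)
\<close>

definition ereal_interval :: "ereal set \<Rightarrow> bool" where
  "ereal_interval I \<longleftrightarrow> (\<forall>x\<in>I. \<forall>y\<in>I. {x..y} \<subseteq> I)"

definition real_part :: "ereal set \<Rightarrow> real set" where
  "real_part I = {x. ereal x \<in> I}"

text \<open>
  Reading of the statement: functions on \<open>I\<close> are total on \<open>ereal\<close> but used only on \<open>I\<close>, and derivatives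
  are taken within the real part of \<open>I\<close>, hence one-sided at a real endpoint belonging to \<open>I\<close>.

  Besides differentiability, \<open>f\<close> and \<open>g\<close> are assumed continuous on \<open>I\<close> (in the topology of the extended
  reals). At the real points of \<open>I\<close> this follows from differentiability, so it is a condition only at a
  point \<open>-\<infinity>\<close> or \<open>\<infinity>\<close> belonging to \<open>I\<close>. It cannot be dropped there: for \<open>I = [0,\<infinity>]\<close>, \<open>c = \<infinity>\<close>,
  \<open>f x = x\<^sup>2\<close> and \<open>g x = x\<close> at real \<open>x\<close>, \<open>f \<infinity> = -5\<close>, \<open>g \<infinity> = -1\<close>, the quotient \<open>f' / g'\<close> is strictly
  increasing, but \<open>(f x - f c) / (g x - g c)\<close> is 5 at 0 and 3 at 1.

  Since division by zero is total, that \<open>g x - g c\<close> does not vanish for \<open>x \<noteq> c\<close> is stated explicitly.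
\<close>

end

theory Submission
  imports Defs
begin

text \<open>
  Write \<open>r = f' / g'\<close> and let \<open>Q x\<close> be the quotient \<open>(f x - f c) / (g x - g c)\<close>. All four monotonicity
  claims are read off from one identity: for \<open>x < y\<close> in \<open>I - {c}\<close> there are real points \<open>\<xi> < \<eta>\<close> of \<open>I\<close>
  and a number \<open>s > 0\<close> with \<open>Q y - Q x = s * (r \<eta> - r \<xi>)\<close> (lemma \<open>quotient_increment\<close>).

  The ingredient is Cauchy's mean value theorem on intervals whose endpoints may be infinite. Its
  usual proof carries over: a closed interval of extended reals is compact, so Rolle's argument
  finds an extremum of a continuous function, and an interior point of the interval is automatically
  a real number, where the derivative must vanish. Rolle's theorem also makes \<open>g\<close> injective, hence
  strictly monotonic by continuity; in particular no difference of values of \<open>g\<close> at distinct points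
  is zero.

  If \<open>x < c < y\<close>, then \<open>Q x\<close> and \<open>Q y\<close> are values of \<open>r\<close> on either side of \<open>c\<close>, and \<open>s = 1\<close>. If \<open>c\<close>
  lies outside \<open>[x, y]\<close>, take the three points in increasing order and call the ratio of the
  increments of \<open>f\<close> and \<open>g\<close> over an interval its slope. The slope of the whole interval is a weighted
  average of the slopes of its two parts, with positive weights because \<open>g\<close> is strictly monotonic.
  One of \<open>Q x\<close>, \<open>Q y\<close> is the slope of the whole and the other the slope of the part adjacent to \<open>c\<close>, so
  \<open>Q y - Q x\<close> is a positive multiple of the right slope minus the left slope. By the mean value
  theorem these two slopes are values of \<open>r\<close> in the respective parts.
\<close>

section \<open>Mean value theorems on extended real intervals\<close>

lemma at_within_real_part:
  assumes "{a<..<b} \<subseteq> I" and "a < ereal t" and "ereal t < b"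
  shows "at t within real_part I = at t"
proof (rule at_within_open_subset)
  show "t \<in> {t. a < ereal t \<and> ereal t < b}" using assms by simp
  show "open {t. a < ereal t \<and> ereal t < b}"
    by (intro open_Collect_conj open_Collect_less continuous_intros)
  show "{t. a < ereal t \<and> ereal t < b} \<subseteq> real_part I"
    using assms(1) by (auto simp: real_part_def)
qed

text \<open>
  Infinite endpoints are harmless: the extrema exist because \<open>[a, b]\<close> is compact in the topology of
  the extended reals, and the derivative is taken only at interior points, which are real.
\<close>

lemma Rolle_ereal:
  fixes h :: "ereal \<Rightarrow> real" and h' :: "real \<Rightarrow> real"
  assumes "a < b" and cont: "continuous_on {a..b} h" and "h a = h b"
    and deriv: "\<And>t. a < ereal t \<Longrightarrow> ereal t < b \<Longrightarrow>
                  ((\<lambda>t. h (ereal t)) has_real_derivative h' t) (at t)"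
  obtains \<xi> where "a < ereal \<xi>" "ereal \<xi> < b" "h' \<xi> = 0"
proof -
  let ?U = "{t. a < ereal t \<and> ereal t < b}"
  have U: "open ?U"
    by (intro open_Collect_conj open_Collect_less continuous_intros)
  have extremum_real: "\<exists>t. m = ereal t" if "a < m" "m < b" for m
    using that by (cases m) auto
  have compact: "compact {a..b}" by (simp add: compact_eq_closed)
  have nonempty: "{a..b} \<noteq> {}" using \<open>a < b\<close> by simp
  obtain M where M: "M \<in> {a..b}" "\<And>x. x \<in> {a..b} \<Longrightarrow> h x \<le> h M"
    using continuous_attains_sup[OF compact nonempty cont] by blast
  obtain m where m: "m \<in> {a..b}" "\<And>x. x \<in> {a..b} \<Longrightarrow> h m \<le> h x"
    using continuous_attains_inf[OF compact nonempty cont] by blast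
  \<comment> \<open>If both extrema sit at the endpoints, then \<open>h\<close> is constant and every interior point serves.\<close>
  obtain \<xi> where \<xi>: "\<xi> \<in> ?U"
    and ext: "(\<forall>t\<in>?U. h (ereal t) \<le> h (ereal \<xi>)) \<or> (\<forall>t\<in>?U. h (ereal \<xi>) \<le> h (ereal t))"
  proof (cases "a < M \<and> M < b")
    case True
    then obtain t where "M = ereal t" using extremum_real by blast
    then show ?thesis using that[of t] True M(2) by (simp add: less_imp_le)
  next
    case M_end: False
    show ?thesis
    proof (cases "a < m \<and> m < b")
      case True
      then obtain t where "m = ereal t" using extremum_real by blast
      then show ?thesis using that[of t] True m(2) by (simp add: less_imp_le)
    next
      case False
      have "M = a \<or> M = b" "m = a \<or> m = b"
        using False M_end M(1) m(1) by (simp_all add: not_less order_eq_iff)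
      then have "h M = h a" "h m = h a" using \<open>h a = h b\<close> by auto
      then have const: "h x = h a" if "x \<in> {a..b}" for x
        using M(2)[OF that] m(2)[OF that] by simp
      obtain t where t: "a < ereal t" "ereal t < b" using ereal_dense2[OF \<open>a < b\<close>] by blast
      have "h (ereal u) \<le> h (ereal t)" if "u \<in> ?U" for u
        using that t const[of "ereal u"] const[of "ereal t"] by (simp add: less_imp_le)
      then show ?thesis using that[of t] t by blast
    qed
  qed
  have "(*) (h' \<xi>) = (\<lambda>v. 0)"
    using differential_zero_maxmin[OF \<xi> U, of "\<lambda>t. h (ereal t)"] deriv[of \<xi>] \<xi> ext
    by (simp add: has_field_derivative_def)
  then have "h' \<xi> = 0" by (auto dest: fun_cong[of _ _ 1])
  then show ?thesis using that \<xi> by blast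
qed

locale differentiable_pair =
  fixes I :: "ereal set" and f g :: "ereal \<Rightarrow> real" and f' g' :: "real \<Rightarrow> real"
  assumes interval: "ereal_interval I"
    and cont_f: "continuous_on I f" and cont_g: "continuous_on I g"
    and deriv_f: "\<And>x. x \<in> real_part I \<Longrightarrow>
           ((\<lambda>t. f (ereal t)) has_real_derivative f' x) (at x within real_part I)"
    and deriv_g: "\<And>x. x \<in> real_part I \<Longrightarrow>
           ((\<lambda>t. g (ereal t)) has_real_derivative g' x) (at x within real_part I)"
    and g'_nonzero: "\<And>x. x \<in> real_part I \<Longrightarrow> g' x \<noteq> 0"
begin

text \<open>
  The quotient of the theorem is \<open>slope c\<close>. Symmetry in the two points lets the results about
  \<open>slope a b\<close> with \<open>a < b\<close> serve on both sides of \<open>c\<close>.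
\<close>

definition slope :: "ereal \<Rightarrow> ereal \<Rightarrow> real" where
  "slope a b = (f b - f a) / (g b - g a)"

lemma slope_commute: "slope a b = slope b a"
  unfolding slope_def using minus_divide_divide[of "f a - f b" "g a - g b"] by simp

lemma Icc_subset: "a \<in> I \<Longrightarrow> b \<in> I \<Longrightarrow> {a..b} \<subseteq> I"
  using interval by (auto simp: ereal_interval_def)

lemma between_in_I: "a \<in> I \<Longrightarrow> b \<in> I \<Longrightarrow> a < x \<Longrightarrow> x < b \<Longrightarrow> x \<in> I"
  using Icc_subset[of a b] atLeastAtMost_iff[of x a b] less_imp_le by blast

lemma interior_in_real_part:
  assumes "a \<in> I" "b \<in> I" "a < ereal t" "ereal t < b"
  shows "t \<in> real_part I"
  using between_in_I[OF assms] by (simp add: real_part_def)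

lemma interior_derivs:
  assumes "a \<in> I" "b \<in> I" "a < ereal t" "ereal t < b"
  shows "((\<lambda>t. f (ereal t)) has_real_derivative f' t) (at t)"
    and "((\<lambda>t. g (ereal t)) has_real_derivative g' t) (at t)"
proof -
  have "{a<..<b} \<subseteq> I" using between_in_I[OF assms(1,2)] by auto
  from at_within_real_part[OF this assms(3,4)]
  show "((\<lambda>t. f (ereal t)) has_real_derivative f' t) (at t)"
    and "((\<lambda>t. g (ereal t)) has_real_derivative g' t) (at t)"
    using deriv_f[OF interior_in_real_part[OF assms]] deriv_g[OF interior_in_real_part[OF assms]]
    by simp_all
qed

lemma g_neq:
  assumes "a \<in> I" "b \<in> I" "a < b"
  shows "g a \<noteq> g b"
proof
  assume "g a = g b"
  then obtain \<xi> where "a < ereal \<xi>" "ereal \<xi> < b" "g' \<xi> = 0"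
    using Rolle_ereal[OF assms(3) continuous_on_subset[OF cont_g Icc_subset[OF assms(1,2)]]
        _ interior_derivs(2)[OF assms(1,2)]] by blast
  then show False using g'_nonzero interior_in_real_part[OF assms(1,2)] by blast
qed

lemma inj_on_g: "inj_on g I"
  by (rule linorder_inj_onI) (use g_neq in auto)

text \<open>
  The classical device: a linear combination \<open>h\<close> of \<open>f\<close> and \<open>g\<close> with equal values at the endpoints
  turns Rolle's theorem into a statement about \<open>slope a b\<close>.
\<close>

lemma Cauchy_mean_value:
  assumes "a \<in> I" "b \<in> I" "a < b"
  obtains \<xi> where "a < ereal \<xi>" "ereal \<xi> < b" "\<xi> \<in> real_part I" "slope a b = f' \<xi> / g' \<xi>"
proof -
  define h where "h x = (f b - f a) * g x - (g b - g a) * f x" for x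
  have "continuous_on {a..b} h"
    unfolding h_def using Icc_subset[OF assms(1,2)]
    by (intro continuous_intros continuous_on_subset[OF cont_f] continuous_on_subset[OF cont_g])
  moreover have "h a = h b" by (simp add: h_def algebra_simps)
  moreover have deriv: "((\<lambda>t. h (ereal t)) has_real_derivative (f b - f a) * g' t - (g b - g a) * f' t) (at t)"
    if "a < ereal t" "ereal t < b" for t
    unfolding h_def
    by (intro DERIV_diff DERIV_cmult interior_derivs[OF assms(1,2) that])
  ultimately obtain \<xi> where \<xi>: "a < ereal \<xi>" "ereal \<xi> < b"
    and eq: "(f b - f a) * g' \<xi> - (g b - g a) * f' \<xi> = 0"
    using Rolle_ereal[OF \<open>a < b\<close> _ _ deriv] by blast
  have in_I: "\<xi> \<in> real_part I" using interior_in_real_part[OF assms(1,2) \<xi>] .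
  have "slope a b = f' \<xi> / g' \<xi>"
    using eq g'_nonzero[OF in_I] g_neq[OF assms] by (simp add: slope_def frac_eq_eq mult.commute)
  then show ?thesis using that \<xi> in_I by blast
qed

section \<open>Comparing slopes\<close>

text \<open>
  The weight is \<open>s = (g z - g y) / (g z - g x)\<close>. It lies strictly between 0 and 1 because a
  continuous injective function takes at \<open>y\<close> a value strictly between those at \<open>x\<close> and \<open>z\<close>.
\<close>

lemma slope_weighted_average:
  assumes "x \<in> I" "z \<in> I" "x < y" "y < z"
  obtains s where "0 < s" "s < 1" "slope x z = (1 - s) * slope x y + s * slope y z"
proof -
  let ?s = "(g z - g y) / (g z - g x)"
  note sub = Icc_subset[OF assms(1,2)]
  have between: "g x < g y \<and> g y < g z \<or> g z < g y \<and> g y < g x"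
    using continuous_inj_imp_mono[OF assms(3,4) continuous_on_subset[OF cont_g sub]
        inj_on_subset[OF inj_on_g sub]] by auto
  then have nz: "g y - g x \<noteq> 0" "g z - g y \<noteq> 0" "g z - g x \<noteq> 0" by auto
  have "1 - ?s = (g y - g x) / (g z - g x)" using nz by (simp add: field_simps)
  then have "(1 - ?s) * slope x y + ?s * slope y z
      = (f y - f x) / (g z - g x) + (f z - f y) / (g z - g x)"
    using nz by (simp add: slope_def)
  also have "\<dots> = slope x z" by (simp add: slope_def add_divide_distrib[symmetric])
  finally have "slope x z = (1 - ?s) * slope x y + ?s * slope y z" ..
  moreover have "0 < ?s" "?s < 1" using between by (auto simp: divide_simps)
  ultimately show ?thesis using that by blast
qed

lemma adjacent_slopes:
  assumes "x \<in> I" "z \<in> I" "x < y" "y < z"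
  obtains \<xi> \<eta> where "\<xi> \<in> real_part I" "\<eta> \<in> real_part I" "\<xi> < \<eta>"
    "slope x y = f' \<xi> / g' \<xi>" "slope y z = f' \<eta> / g' \<eta>"
proof -
  have "y \<in> I" using between_in_I[OF assms] .
  obtain \<xi> where \<xi>: "ereal \<xi> < y" "\<xi> \<in> real_part I" "slope x y = f' \<xi> / g' \<xi>"
    using Cauchy_mean_value[OF \<open>x \<in> I\<close> \<open>y \<in> I\<close> \<open>x < y\<close>] by metis
  obtain \<eta> where \<eta>: "y < ereal \<eta>" "\<eta> \<in> real_part I" "slope y z = f' \<eta> / g' \<eta>"
    using Cauchy_mean_value[OF \<open>y \<in> I\<close> \<open>z \<in> I\<close> \<open>y < z\<close>] by metis
  have "\<xi> < \<eta>" using less_trans[OF \<xi>(1) \<eta>(1)] by simp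
  then show ?thesis using that \<xi> \<eta> by blast
qed

text \<open>
  Every monotonicity of \<open>f' / g'\<close>, increasing or decreasing, weak or strict, is a statement about
  the sign of its increments; since \<open>s > 0\<close>, the increments of \<open>slope c\<close> inherit that sign.
\<close>

lemma quotient_increment:
  assumes "c \<in> I" "x \<in> I - {c}" "y \<in> I - {c}" "x < y"
  obtains \<xi> \<eta> s where "\<xi> \<in> real_part I" "\<eta> \<in> real_part I" "\<xi> < \<eta>" "0 < s"
    "slope c y - slope c x = s * (f' \<eta> / g' \<eta> - f' \<xi> / g' \<xi>)"
proof -
  have I: "x \<in> I" "y \<in> I" using assms by auto
  consider "x < c" "c < y" | "c < x" | "y < c"
    using assms by fastforce
  then show ?thesis
  proof cases
    case 1
    obtain \<xi> \<eta> where "\<xi> \<in> real_part I" "\<eta> \<in> real_part I" "\<xi> < \<eta>"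
      "slope x c = f' \<xi> / g' \<xi>" "slope c y = f' \<eta> / g' \<eta>"
      using adjacent_slopes[OF I 1] .
    then show ?thesis using that[of \<xi> \<eta> 1] slope_commute[of x c] by simp
  next
    case 2
    obtain s where "0 < s" "slope c y = (1 - s) * slope c x + s * slope x y"
      using slope_weighted_average[OF \<open>c \<in> I\<close> \<open>y \<in> I\<close> 2 \<open>x < y\<close>] by blast
    then have "slope c y - slope c x = s * (slope x y - slope c x)"
      by (simp add: algebra_simps)
    with \<open>0 < s\<close> show ?thesis
      using adjacent_slopes[OF \<open>c \<in> I\<close> \<open>y \<in> I\<close> 2 \<open>x < y\<close>] that by metis
  next
    case 3
    obtain s where "s < 1" "slope x c = (1 - s) * slope x y + s * slope y c"
      using slope_weighted_average[OF \<open>x \<in> I\<close> \<open>c \<in> I\<close> \<open>x < y\<close> 3] by blast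
    then have "slope c y - slope c x = (1 - s) * (slope y c - slope x y)"
      by (simp add: algebra_simps slope_commute[of c])
    moreover have "0 < 1 - s" using \<open>s < 1\<close> by simp
    ultimately show ?thesis
      using adjacent_slopes[OF \<open>x \<in> I\<close> \<open>c \<in> I\<close> \<open>x < y\<close> 3] that by metis
  qed
qed

end

section \<open>The monotonicity rule\<close>

theorem theorem2:
  fixes I :: "ereal set" and c :: ereal
    and f g :: "ereal \<Rightarrow> real" and f' g' :: "real \<Rightarrow> real"
  assumes "ereal_interval I" and "c \<in> I"
    and "continuous_on I f" and "continuous_on I g"
    and "\<And>x. x \<in> real_part I \<Longrightarrow>
           ((\<lambda>t. f (ereal t)) has_real_derivative f' x) (at x within real_part I)"
    and "\<And>x. x \<in> real_part I \<Longrightarrow>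
           ((\<lambda>t. g (ereal t)) has_real_derivative g' x) (at x within real_part I)"
    and "\<And>x. x \<in> real_part I \<Longrightarrow> g' x \<noteq> 0"
  shows "(\<forall>x \<in> I - {c}. g x - g c \<noteq> 0)
    \<and> (mono_on (real_part I) (\<lambda>x. f' x / g' x)
         \<longrightarrow> mono_on (I - {c}) (\<lambda>x. (f x - f c) / (g x - g c)))
    \<and> (antimono_on (real_part I) (\<lambda>x. f' x / g' x)
         \<longrightarrow> antimono_on (I - {c}) (\<lambda>x. (f x - f c) / (g x - g c)))
    \<and> (strict_mono_on (real_part I) (\<lambda>x. f' x / g' x)
         \<longrightarrow> strict_mono_on (I - {c}) (\<lambda>x. (f x - f c) / (g x - g c)))
    \<and> (strict_antimono_on (real_part I) (\<lambda>x. f' x / g' x)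
         \<longrightarrow> strict_antimono_on (I - {c}) (\<lambda>x. (f x - f c) / (g x - g c)))"
proof -
  interpret differentiable_pair I f g f' g'
    by unfold_locales (use assms in auto)
  have nonzero: "g x - g c \<noteq> 0" if "x \<in> I - {c}" for x
    using that inj_on_g \<open>c \<in> I\<close> by (auto dest: inj_onD)
  have mono: "mono_on (I - {c}) (slope c)" if r: "mono_on (real_part I) (\<lambda>x. f' x / g' x)"
  proof (rule mono_onI)
    fix x y assume xy: "x \<in> I - {c}" "y \<in> I - {c}" "x \<le> y"
    show "slope c x \<le> slope c y"
    proof (cases "x = y")
      case False
      with xy have "x < y" by simp
      obtain \<xi> \<eta> s where *: "\<xi> \<in> real_part I" "\<eta> \<in> real_part I" "\<xi> < \<eta>" "0 < s"
        "slope c y - slope c x = s * (f' \<eta> / g' \<eta> - f' \<xi> / g' \<xi>)"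
        using quotient_increment[OF \<open>c \<in> I\<close> xy(1,2) \<open>x < y\<close>] .
      have "f' \<xi> / g' \<xi> \<le> f' \<eta> / g' \<eta>" using mono_onD[OF r *(1,2)] *(3) by simp
      then have "0 \<le> s * (f' \<eta> / g' \<eta> - f' \<xi> / g' \<xi>)" using \<open>0 < s\<close> by simp
      then show ?thesis using *(5) by simp
    qed simp
  qed
  have antimono: "antimono_on (I - {c}) (slope c)"
    if r: "antimono_on (real_part I) (\<lambda>x. f' x / g' x)"
  proof (rule monotone_onI)
    fix x y assume xy: "x \<in> I - {c}" "y \<in> I - {c}" "x \<le> y"
    show "slope c y \<le> slope c x"
    proof (cases "x = y")
      case False
      with xy have "x < y" by simp
      obtain \<xi> \<eta> s where *: "\<xi> \<in> real_part I" "\<eta> \<in> real_part I" "\<xi> < \<eta>" "0 < s"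
        "slope c y - slope c x = s * (f' \<eta> / g' \<eta> - f' \<xi> / g' \<xi>)"
        using quotient_increment[OF \<open>c \<in> I\<close> xy(1,2) \<open>x < y\<close>] .
      have "f' \<eta> / g' \<eta> \<le> f' \<xi> / g' \<xi>" using monotone_onD[OF r *(1,2)] *(3) by simp
      then have "s * (f' \<eta> / g' \<eta> - f' \<xi> / g' \<xi>) \<le> 0"
        using \<open>0 < s\<close> by (simp add: mult_le_0_iff)
      then show ?thesis using *(5) by simp
    qed simp
  qed
  have strict_mono: "strict_mono_on (I - {c}) (slope c)"
    if r: "strict_mono_on (real_part I) (\<lambda>x. f' x / g' x)"
  proof (rule monotone_onI)
    fix x y assume xy: "x \<in> I - {c}" "y \<in> I - {c}" "x < y"
    obtain \<xi> \<eta> s where *: "\<xi> \<in> real_part I" "\<eta> \<in> real_part I" "\<xi> < \<eta>" "0 < s"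
      "slope c y - slope c x = s * (f' \<eta> / g' \<eta> - f' \<xi> / g' \<xi>)"
      using quotient_increment[OF \<open>c \<in> I\<close> xy] .
    have "f' \<xi> / g' \<xi> < f' \<eta> / g' \<eta>" using monotone_onD[OF r *(1-3)] .
    then have "0 < s * (f' \<eta> / g' \<eta> - f' \<xi> / g' \<xi>)" using \<open>0 < s\<close> by simp
    then show "slope c x < slope c y" using *(5) by simp
  qed
  have strict_antimono: "strict_antimono_on (I - {c}) (slope c)"
    if r: "strict_antimono_on (real_part I) (\<lambda>x. f' x / g' x)"
  proof (rule monotone_onI)
    fix x y assume xy: "x \<in> I - {c}" "y \<in> I - {c}" "x < y"
    obtain \<xi> \<eta> s where *: "\<xi> \<in> real_part I" "\<eta> \<in> real_part I" "\<xi> < \<eta>" "0 < s"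
      "slope c y - slope c x = s * (f' \<eta> / g' \<eta> - f' \<xi> / g' \<xi>)"
      using quotient_increment[OF \<open>c \<in> I\<close> xy] .
    have "f' \<eta> / g' \<eta> < f' \<xi> / g' \<xi>" using monotone_onD[OF r *(1-3)] .
    then have "s * (f' \<eta> / g' \<eta> - f' \<xi> / g' \<xi>) < 0"
      using \<open>0 < s\<close> by (simp add: mult_less_0_iff)
    then show "slope c y < slope c x" using *(5) by simp
  qed
  have "slope c = (\<lambda>x. (f x - f c) / (g x - g c))"
    by (simp add: fun_eq_iff slope_def)
  with nonzero mono antimono strict_mono strict_antimono show ?thesis
    by auto
qed

end
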